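(* Let $\mathfrak{X},\mathfrak{Y},\mathfrak{Z}$ be linear spaces over $\mathbb{K}$ and let $A\subseteq\mathfrak{X}\times\mathfrak{Z}$ and $B\subseteq\mathfrak{X}\times\mathfrak{Y}$ be two linear relations. The following statements are equivalent: (i) there exists an operator $C$ between $\mathfrak{Y}$ and $\mathfrak{Z}$ such that $A\subseteq CB$; (ii) $\mathrm{dom}\,A\subseteq\mathrm{dom}\,B$ and $\dim(\mathrm{mul}\,B)\ge\dim[A(\mathrm{dom}\,A\cap\ker B)]$.
   Context: $\mathbb{K}$ is $\mathbb{R}$ or $\mathbb{C}$. A linear relation between linear spaces $\mathfrak{X}$ and $\mathfrak{Y}$ is a linear subspace $R$ of $\mathfrak{X}\times\mathfrak{Y}$. For a subset $\mathfrak{X}_0\subseteq\mathfrak{X}$, $R(\mathfrak{X}_0)=\{y:(x,y)\in R\text{ for some }x\in\mathfrak{X}_0\}$. Put $\mathrm{dom}\,R=\{x:(x,y)\in R\text{ for some }y\}$, $\ker R=\{x:(x,0)\in R\}$, $\mathrm{mul}\,R=\{y:(0,y)\in R\}$. For linear relations $R\subseteq\mathfrak{X}\times\mathfrak{Y}$ and $S\subseteq\mathfrak{Y}\times\mathfrak{Z}$ the product is $SR=\{(x,z):(x,y)\in R\text{ and }(y,z)\in S\text{ for some }y\in\mathfrak{Y}\}$. An operator between $\mathfrak{X}$ and $\mathfrak{Y}$ is a linear map defined on a linear subspace of $\mathfrak{X}$ (not necessarily all of $\mathfrak{X}$) with values in $\mathfrak{Y}$; it is identified with its graph, i.e. with a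 linear relation with $\mathrm{mul}\,R=\{0\}$. $\dim$ is the algebraic dimension (cardinality of a Hamel basis), a possibly infinite cardinal. *)

theory Defs
  imports Complex_Main "HOL-Analysis.Product_Vector"
begin

unbundle cardinal_syntax

text \<open>A type of this class is a copy of the field of real or of complex numbers, so that one type
  variable for the scalars covers both cases.\<close>

class real_or_complex = field +
  assumes real_or_complex:
    "(\<exists>f :: 'a \<Rightarrow> real. bij f \<and> f 1 = 1 \<and>
       (\<forall>x y. f (x + y) = f x + f y) \<and> (\<forall>x y. f (x * y) = f x * f y)) \<or>
     (\<exists>f :: 'a \<Rightarrow> complex. bij f \<and> f 1 = 1 \<and>
       (\<forall>x y. f (x + y) = f x + f y) \<and> (\<forall>x y. f (x * y) = f x * f y))"

instance real :: real_or_complex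
  by standard (rule disjI1, rule exI[of _ id], simp)

instance complex :: real_or_complex
  by standard (rule disjI2, rule exI[of _ id], simp)

text \<open>The domain of a relation, the image of a set, and the product of relations are the library's
  \<open>Domain R\<close>, \<open>R `` X\<close>, and \<open>R O S\<close>; the latter is written in diagrammatic order, so that
  the product \<open>S R\<close> (first \<open>R\<close>, then \<open>S\<close>) is \<open>R O S\<close>.\<close>

definition linear_relation ::
  "('k::field \<Rightarrow> 'x::ab_group_add \<Rightarrow> 'x) \<Rightarrow> ('k \<Rightarrow> 'y::ab_group_add \<Rightarrow> 'y) \<Rightarrow> ('x \<times> 'y) set \<Rightarrow> bool"
  where "linear_relation sX sY R \<longleftrightarrow> module.subspace (module_prod.scale sX sY) R"

definition ker_rel :: "('x \<times> 'y::zero) set \<Rightarrow> 'x set" where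
  "ker_rel R = {x. (x, 0) \<in> R}"

definition mul_rel :: "('x::zero \<times> 'y) set \<Rightarrow> 'y set" where
  "mul_rel R = {y. (0, y) \<in> R}"

text \<open>Operators are identified with their graphs; they need not be everywhere defined.\<close>

definition linear_operator ::
  "('k::field \<Rightarrow> 'x::ab_group_add \<Rightarrow> 'x) \<Rightarrow> ('k \<Rightarrow> 'y::ab_group_add \<Rightarrow> 'y) \<Rightarrow> ('x \<times> 'y) set \<Rightarrow> bool"
  where "linear_operator sX sY R \<longleftrightarrow> linear_relation sX sY R \<and> mul_rel R = {0}"

definition hamel_basis ::
  "('k::field \<Rightarrow> 'v::ab_group_add \<Rightarrow> 'v) \<Rightarrow> 'v set \<Rightarrow> 'v set \<Rightarrow> bool"
  where "hamel_basis s V b \<longleftrightarrow> \<not> module.dependent s b \<and> module.span s b = V"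

text \<open>The library's \<open>dim\<close> is a natural number, equal to 0 in the infinite-dimensional case. Here the
  dimension of a subspace is a cardinal, to be compared by \<open>\<le>o\<close>; by the lemmas below,
  it does not depend on the chosen basis.\<close>

definition hamel_dim ::
  "('k::field \<Rightarrow> 'v::ab_group_add \<Rightarrow> 'v) \<Rightarrow> 'v set \<Rightarrow> 'v rel"
  where "hamel_dim s V = |SOME b. hamel_basis s V b|"

lemma hamel_basis_exists:
  assumes "vector_space s" and "module.subspace s V"
  shows "\<exists>b. hamel_basis s V b"
proof -
  interpret vector_space s by fact
  obtain b where "b \<subseteq> V" "independent b" "V \<subseteq> span b"
    using maximal_independent_subset by blast
  then show ?thesis
    unfolding hamel_basis_def using span_subspace[OF _ _ assms(2)] by blast
qed

lemma hamel_dim_eq: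
  assumes "vector_space s" and "hamel_basis s V b"
  shows "hamel_dim s V =o |b|"
proof -
  interpret vector_space s by fact
  have "hamel_basis s V (SOME b. hamel_basis s V b)"
    using assms(2) by (rule someI)
  then have "\<exists>f. bij_betw f (SOME b. hamel_basis s V b) b"
    using assms(2) unfolding hamel_basis_def by (intro bij_if_span_eq_span_bases) auto
  then show ?thesis
    unfolding hamel_dim_def using card_of_ordIso by blast
qed

end

theory Submission
  imports Defs
begin

text \<open>If \<open>A \<subseteq> C B\<close>, then \<open>C\<close> maps a part of \<open>mul B\<close> onto \<open>A(dom A \<inter> ker B)\<close>, and a linear right
  inverse of \<open>C\<close> embeds the latter in \<open>mul B\<close>. Conversely, the linear relation \<open>D = A B\<^sup>-\<^sup>1\<close> has
  \<open>mul D = A(dom A \<inter> ker B)\<close> and contains \<open>mul B \<times> mul D\<close>. The dimension condition gives a linear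
  map from \<open>mul B\<close> onto \<open>mul D\<close>; extended to a linear selection \<open>C\<close> of \<open>D\<close> on \<open>dom D\<close>, it satisfies
  \<open>A \<subseteq> C B\<close>, because the error made by the selection lies in \<open>mul D = C(mul B)\<close>.\<close>

text \<open>Turns membership in a subspace of the product into closure conditions on pairs, the form
  in which \<open>R\<close> and \<open>R\<inverse>\<close> are visibly symmetric.\<close>

lemma linear_relation_iff:
  assumes "vector_space sX" and "vector_space sY"
  shows "linear_relation sX sY R \<longleftrightarrow> (0, 0) \<in> R \<and>
    (\<forall>x y x' y'. (x, y) \<in> R \<longrightarrow> (x', y') \<in> R \<longrightarrow> (x + x', y + y') \<in> R) \<and>
    (\<forall>c x y. (x, y) \<in> R \<longrightarrow> (sX c x, sY c y) \<in> R)"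
proof -
  interpret X: vector_space sX by fact
  interpret Y: vector_space sY by fact
  interpret P: module_prod sX sY by unfold_locales
  show ?thesis
    unfolding linear_relation_def P.p.subspace_def by (fastforce simp: P.scale_def zero_prod_def)
qed

lemma linear_relation_diff:
  assumes "vector_space sX" and "vector_space sY" and R: "linear_relation sX sY R"
    and "(x, y) \<in> R" and "(x', y') \<in> R"
  shows "(x - x', y - y') \<in> R"
proof -
  interpret X: vector_space sX by fact
  interpret Y: vector_space sY by fact
  interpret P: module_prod sX sY by unfold_locales
  show ?thesis
    using P.p.subspace_diff[of R "(x, y)" "(x', y')"] assms by (simp add: linear_relation_def)
qed

lemma linear_relation_converse:
  assumes "vector_space sX" and "vector_space sY" and "linear_relation sX sY R"
  shows "linear_relation sY sX (R\<inverse>)"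
  using assms by (simp add: linear_relation_iff)

lemma linear_relation_relcomp:
  assumes "vector_space sX" and "vector_space sY" and "vector_space sZ"
    and "linear_relation sX sY R" and "linear_relation sY sZ S"
  shows "linear_relation sX sZ (R O S)"
  using assms unfolding linear_relation_iff[OF assms(1,2)] linear_relation_iff[OF assms(2,3)]
    linear_relation_iff[OF assms(1,3)] by (meson relcompE relcompI relcompEpair)

lemma subspace_mul_rel:
  assumes X: "vector_space sX" and Y: "vector_space sY" and R: "linear_relation sX sY R"
  shows "module.subspace sY (mul_rel R)"
proof -
  interpret X: vector_space sX by fact
  interpret Y: vector_space sY by fact
  show ?thesis
    using R X.scale_zero_right unfolding linear_relation_iff[OF X Y] Y.subspace_def mul_rel_def
    by (metis (mono_tags, lifting) add_0 mem_Collect_eq)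
qed

text \<open>For any linear \<open>g\<close> the vectors \<open>v\<close> with
  \<open>(v, g v) \<in> R\<close> form a subspace, so a selection from \<open>R\<close> needs
  checking only on the independent set \<open>b\<close>. It serves both to invert an operator (with
  \<open>R\<close> its converse) and to select from a multivalued relation.\<close>

lemma linear_selection_extend:
  assumes X: "vector_space sX" and Y: "vector_space sY" and R: "linear_relation sX sY R"
    and b: "\<not> module.dependent sX b" and f: "\<And>v. v \<in> b \<Longrightarrow> (v, f v) \<in> R"
  obtains g where "Vector_Spaces.linear sX sY g" and "\<And>v. v \<in> b \<Longrightarrow> g v = f v"
    and "\<And>v. v \<in> module.span sX b \<Longrightarrow> (v, g v) \<in> R"
proof -
  interpret X: vector_space sX by fact
  interpret Y: vector_space sY by fact
  interpret vector_space_pair sX sY by unfold_locales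
  obtain g where g: "Vector_Spaces.linear sX sY g" "\<forall>v\<in>b. g v = f v"
    using linear_independent_extend[OF b] by blast
  interpret g: Vector_Spaces.linear sX sY g by fact
  have "X.subspace {v. (v, g v) \<in> R}"
    using R unfolding linear_relation_iff[OF X Y] X.subspace_def
    by (simp add: g.zero g.add g.scale)
  then have "(v, g v) \<in> R" if "v \<in> X.span b" for v
    using X.span_minimal[of b "{v. (v, g v) \<in> R}"] f g(2) that by (simp add: subset_iff)
  with g that show thesis by blast
qed

lemma linear_relation_graph:
  assumes "Vector_Spaces.linear sX sY g"
  shows "linear_relation sX sY {(v, g v) | v. True}"
proof -
  interpret g: Vector_Spaces.linear sX sY g by fact
  show ?thesis
    using g.vs1.vector_space_axioms g.vs2.vector_space_axioms
    by (auto simp: linear_relation_iff g.zero g.add g.scale)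
qed

lemma linear_operator_graph:
  assumes "Vector_Spaces.linear sX sY g"
  shows "linear_operator sX sY {(v, g v) | v. True}"
proof -
  interpret g: Vector_Spaces.linear sX sY g by fact
  show ?thesis
    using linear_relation_graph[OF assms] by (simp add: linear_operator_def mul_rel_def g.zero)
qed

lemma linear_operator_single_valued:
  assumes X: "vector_space sX" and Y: "vector_space sY" and R: "linear_operator sX sY R"
    and "(x, y) \<in> R" and "(x, y') \<in> R"
  shows "y = y'"
proof -
  have "(x - x, y - y') \<in> R"
    using assms by (intro linear_relation_diff[OF X Y]) (auto simp: linear_operator_def)
  then have "y - y' \<in> mul_rel R"
    by (simp add: mul_rel_def)
  then show ?thesis
    using R by (simp add: linear_operator_def)
qed

text \<open>Choosing preimages in \<open>V\<close> for a basis of \<open>W\<close> and extending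
  linearly gives a right inverse \<open>g\<close> of \<open>C\<close> on \<open>W\<close>. It is
  injective, so it carries the basis to an independent subset of \<open>V\<close>.\<close>

lemma hamel_dim_image_le:
  assumes Y: "vector_space sY" and Z: "vector_space sZ"
    and V: "module.subspace sY V" and W: "module.subspace sZ W"
    and C: "linear_operator sY sZ C" and sub: "W \<subseteq> C `` V"
  shows "hamel_dim sZ W \<le>o hamel_dim sY V"
proof -
  interpret Y: vector_space sY by fact
  interpret Z: vector_space sZ by fact
  interpret vector_space_pair sZ sY by unfold_locales
  obtain c where c: "hamel_basis sZ W c"
    using hamel_basis_exists[OF Z W] by blast
  then have cind: "\<not> Z.dependent c" and cspan: "Z.span c = W"
    by (auto simp: hamel_basis_def)
  have "\<forall>z\<in>c. \<exists>y. y \<in> V \<and> (y, z) \<in> C"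
    using sub cspan Z.span_superset by blast
  then obtain h where h: "\<And>z. z \<in> c \<Longrightarrow> h z \<in> V \<and> (h z, z) \<in> C"
    by metis
  have "linear_relation sZ sY (C\<inverse>)"
    using linear_relation_converse[OF Y Z] C by (simp add: linear_operator_def)
  then obtain g where g: "Vector_Spaces.linear sZ sY g" "\<And>z. z \<in> c \<Longrightarrow> g z = h z"
    "\<And>z. z \<in> Z.span c \<Longrightarrow> (z, g z) \<in> C\<inverse>"
    using linear_selection_extend[OF Z Y _ cind, of "C\<inverse>" h] h by auto
  \<comment> \<open>If \<open>g z = g z'\<close>, then \<open>C\<close> relates this one vector to
    both \<open>z\<close> and \<open>z'\<close>, which therefore coincide.\<close>
  have inj: "inj_on g (Z.span c)"
    using g(3) linear_operator_single_valued[OF Y Z C] by (metis converseD inj_onI)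
  have gind: "\<not> Y.dependent (g ` c)"
    using linear_independent_injective_image[OF g(1) cind inj] .
  have gV: "g ` c \<subseteq> V"
    using g(2) h by auto
  obtain d where d: "g ` c \<subseteq> d" "d \<subseteq> V" "\<not> Y.dependent d" "V \<subseteq> Y.span d"
    using Y.maximal_independent_subset_extend[OF gV gind] by metis
  then have "hamel_basis sY V d"
    using Y.span_subspace[OF d(2) d(4) V] by (simp add: hamel_basis_def)
  have "hamel_dim sZ W =o |c|"
    using hamel_dim_eq[OF Z c] .
  also have "|c| \<le>o |d|"
    using inj d(1) Z.span_superset[of c] card_of_ordLeq inj_on_subset by metis
  also have "|d| =o hamel_dim sY V"
    using hamel_dim_eq[OF Y \<open>hamel_basis sY V d\<close>] by (rule ordIso_symmetric)
  finally show ?thesis .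
qed

text \<open>The inequality gives an injection \<open>i\<close> of a basis \<open>c\<close> of
  \<open>W\<close> into \<open>b\<close>; undoing \<open>i\<close> on its range sends
  \<open>b\<close> onto a set containing \<open>c\<close>.\<close>

lemma hamel_dim_le_imp_surj:
  assumes Y: "vector_space sY" and Z: "vector_space sZ"
    and W: "module.subspace sZ W" and b: "hamel_basis sY V b"
    and le: "hamel_dim sZ W \<le>o hamel_dim sY V"
  obtains f where "f ` b \<subseteq> W" and "W \<subseteq> module.span sZ (f ` b)"
proof -
  interpret Z: vector_space sZ by fact
  obtain c where c: "hamel_basis sZ W c"
    using hamel_basis_exists[OF Z W] by blast
  then have cspan: "Z.span c = W"
    by (simp add: hamel_basis_def)
  have "|c| =o hamel_dim sZ W"
    using hamel_dim_eq[OF Z c] by (rule ordIso_symmetric)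
  also note le
  also have "hamel_dim sY V =o |b|"
    using hamel_dim_eq[OF Y b] .
  finally obtain i where i: "inj_on i c" "i ` c \<subseteq> b"
    using card_of_ordLeq by metis
  \<comment> \<open>The default 0 keeps all values in the subspace \<open>W\<close>.\<close>
  define f where "f v = (if v \<in> i ` c then the_inv_into c i v else 0)" for v
  have "f (i z) = z" if "z \<in> c" for z
    using that i(1) by (simp add: f_def the_inv_into_f_f)
  then have "c \<subseteq> f ` b"
    using i(2) by force
  moreover have "f v \<in> W" for v
    using the_inv_into_into[OF i(1), of v c] cspan Z.span_superset[of c] Z.subspace_0[OF W]
    by (auto simp: f_def)
  ultimately show thesis
    using that[of f] Z.span_mono cspan by blast
qed

theorem theorem5p8:
  fixes sX :: "'k::real_or_complex \<Rightarrow> 'x::ab_group_add \<Rightarrow> 'x"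
    and sY :: "'k \<Rightarrow> 'y::ab_group_add \<Rightarrow> 'y"
    and sZ :: "'k \<Rightarrow> 'z::ab_group_add \<Rightarrow> 'z"
    and A :: "('x \<times> 'z) set"
    and B :: "('x \<times> 'y) set"
  assumes "vector_space sX" and "vector_space sY" and "vector_space sZ"
    and "linear_relation sX sZ A" and "linear_relation sX sY B"
  shows "(\<exists>C. linear_operator sY sZ C \<and> A \<subseteq> B O C) \<longleftrightarrow>
    Domain A \<subseteq> Domain B \<and>
    hamel_dim sZ (A `` (Domain A \<inter> ker_rel B)) \<le>o hamel_dim sY (mul_rel B)"
proof -
  note X = assms(1) and Y = assms(2) and Z = assms(3) and A = assms(4) and B = assms(5)
  interpret X: vector_space sX by fact
  interpret Y: vector_space sY by fact
  interpret Z: vector_space sZ by fact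
  define D where "D = B\<inverse> O A"
  have D: "linear_relation sY sZ D"
    unfolding D_def by (intro linear_relation_relcomp[OF Y X Z] linear_relation_converse X Y A B)
  \<comment> \<open>\<open>(0, z) \<in> D\<close> means that some \<open>x\<close> satisfies
    \<open>(x, 0) \<in> B\<close> and \<open>(x, z) \<in> A\<close>.\<close>
  have mulD: "A `` (Domain A \<inter> ker_rel B) = mul_rel D"
    by (auto simp: D_def mul_rel_def ker_rel_def)
  have subD: "Z.subspace (mul_rel D)"
    by (rule subspace_mul_rel[OF Y Z D])
  have subB: "Y.subspace (mul_rel B)"
    by (rule subspace_mul_rel[OF X Y B])
  show ?thesis
    unfolding mulD
  proof (intro iffI conjI)
    assume "\<exists>C. linear_operator sY sZ C \<and> A \<subseteq> B O C"
    then obtain C where C: "linear_operator sY sZ C" and AC: "A \<subseteq> B O C"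
      by blast
    show "Domain A \<subseteq> Domain B"
      using AC by blast
    have "mul_rel D \<subseteq> C `` mul_rel B"
    proof
      fix z assume "z \<in> mul_rel D"
      then obtain x where x: "(x, 0) \<in> B" "(x, z) \<in> A"
        by (auto simp: mul_rel_def D_def)
      then obtain y where y: "(x, y) \<in> B" "(y, z) \<in> C"
        using AC by blast
      \<comment> \<open>\<open>B\<close> relates \<open>x\<close> to both \<open>y\<close> and 0, so
        their difference lies in \<open>mul_rel B\<close>.\<close>
      have "y \<in> mul_rel B"
        using linear_relation_diff[OF X Y B y(1) x(1)] by (simp add: mul_rel_def)
      with y(2) show "z \<in> C `` mul_rel B"
        by blast
    qed
    then show "hamel_dim sZ (mul_rel D) \<le>o hamel_dim sY (mul_rel B)"
      using hamel_dim_image_le[OF Y Z subB subD C] by blast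
  next
    assume "Domain A \<subseteq> Domain B \<and> hamel_dim sZ (mul_rel D) \<le>o hamel_dim sY (mul_rel B)"
    then have dom: "Domain A \<subseteq> Domain B"
      and le: "hamel_dim sZ (mul_rel D) \<le>o hamel_dim sY (mul_rel B)"
      by auto
    \<comment> \<open>Adding \<open>(0, y)\<close> to a pair \<open>(x, 0) \<in> B\<close> with
      \<open>(x, z) \<in> A\<close> makes \<open>x\<close> a link from \<open>y\<close> to
      \<open>z\<close>.\<close>
    have prod: "(y, z) \<in> D" if y: "y \<in> mul_rel B" and z: "z \<in> mul_rel D" for y z
    proof -
      obtain x where x: "(x, 0) \<in> B" "(x, z) \<in> A"
        using z by (auto simp: mul_rel_def D_def)
      have "(x + 0, 0 + y) \<in> B"
        using B x(1) y unfolding linear_relation_iff[OF X Y] mul_rel_def by blast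
      with x(2) show ?thesis
        by (auto simp: D_def)
    qed
    obtain b where b: "hamel_basis sY (mul_rel B) b"
      using hamel_basis_exists[OF Y subB] by blast
    then have bind: "\<not> Y.dependent b" and bspan: "Y.span b = mul_rel B"
      by (auto simp: hamel_basis_def)
    obtain f where f: "f ` b \<subseteq> mul_rel D" "mul_rel D \<subseteq> Z.span (f ` b)"
      using hamel_dim_le_imp_surj[OF Y Z subD b le] by metis
    have "0 \<in> mul_rel D"
      using Z.subspace_0[OF subD] .
    then have "b \<subseteq> Domain D"
      using prod bspan Y.span_superset[of b] by blast
    then obtain d where d: "b \<subseteq> d" "d \<subseteq> Domain D" "\<not> Y.dependent d" "Domain D \<subseteq> Y.span d"
      using Y.maximal_independent_subset_extend[OF _ bind] by metis
    \<comment> \<open>On \<open>b\<close> the values are those that generate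
      \<open>mul_rel D\<close>; on the rest of \<open>d\<close> any partner under \<open>D\<close>
      will do.\<close>
    define f' where "f' v = (if v \<in> b then f v else SOME z. (v, z) \<in> D)" for v
    have f': "(v, f' v) \<in> D" if "v \<in> d" for v
    proof (cases "v \<in> b")
      case True
      then show ?thesis
        using f(1) prod bspan Y.span_superset[of b] by (simp add: f'_def image_subset_iff subset_iff)
    next
      case False
      then show ?thesis
        using that d(2) by (auto simp: f'_def intro: someI)
    qed
    obtain g where g: "Vector_Spaces.linear sY sZ g" "\<And>v. v \<in> d \<Longrightarrow> g v = f' v"
      "\<And>v. v \<in> Y.span d \<Longrightarrow> (v, g v) \<in> D"
      using linear_selection_extend[OF Y Z D d(3) f'] by blast
    interpret g: Vector_Spaces.linear sY sZ g by fact
    have "g ` b = f ` b"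
      using g(2) d(1) by (intro image_cong) (auto simp: f'_def)
    then have surj: "mul_rel D \<subseteq> g ` mul_rel B"
      using f(2) bspan g.span_image[of b] by simp
    \<comment> \<open>The graph of \<open>g\<close> is taken on the whole space, although
      \<open>g\<close> is a selection of \<open>D\<close> only on \<open>Y.span d\<close>, which
      contains \<open>Domain D\<close>.\<close>
    let ?C = "{(v, g v) | v. True}"
    have "A \<subseteq> B O ?C"
    proof
      fix p assume "p \<in> A"
      then obtain x z where p: "p = (x, z)" "(x, z) \<in> A"
        by (cases p) auto
      then obtain y where y: "(x, y) \<in> B"
        using dom by blast
      then have yz: "(y, z) \<in> D"
        using p(2) by (auto simp: D_def)
      then have "(y, g y) \<in> D"
        using g(3) d(4) by blast
      \<comment> \<open>\<open>D\<close> relates \<open>y\<close> to both \<open>z\<close> and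
        \<open>g y\<close>. Their difference is \<open>g m\<close> for some \<open>m\<close> in
        \<open>mul_rel B\<close>, so replacing \<open>y\<close> by \<open>y + m\<close> corrects the
        value to \<open>z\<close> and keeps the vector related to \<open>x\<close> by
        \<open>B\<close>.\<close>
      then have "z - g y \<in> mul_rel D"
        using linear_relation_diff[OF Y Z D yz] by (fastforce simp: mul_rel_def)
      then obtain m where m: "(0, m) \<in> B" "z - g y = g m"
        using surj by (auto simp: mul_rel_def)
      have "(x + 0, y + m) \<in> B"
        using B y m(1) unfolding linear_relation_iff[OF X Y] by blast
      moreover have "g (y + m) = z"
        by (simp add: g.add flip: m(2))
      ultimately show "p \<in> B O ?C"
        using p(1) by auto
    qed
    then show "\<exists>C. linear_operator sY sZ C \<and> A \<subseteq> B O C"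
      using linear_operator_graph[OF g(1)] by blast
  qed
qed

end
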